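(* Let $n\ge 1$ and let $F:\mathbb{R}^n\to\mathbb{R}^n$ be a vector field of class $\mathcal{C}^1$ such that the autonomous ordinary differential equation $\dot x=F(x)$ defines a global flow $x(t;x_0,t_0)$. Then $x(t;x_0,t_0)$ is differentiable with respect to $(x_0,t_0)$, and for all $t\in\mathbb{R}$, $$\frac{\partial x}{\partial t_0}(t;x_0,t_0)+D_{x_0}x(t;x_0,t_0)\,F(x_0)=0\qquad\text{for all }(x_0,t_0)\in\mathbb{R}^n\times(-\infty,t).$$
   Context: For $(x_0,t_0)\in\mathbb{R}^n\times\mathbb{R}$, $x(t;x_0,t_0)\in\mathbb{R}^n$ denotes the value at time $t$ of the unique solution of $\dot x=F(x)$ with $x(t_0)=x_0$. The flow is called global if, for every $(x_0,t_0)\in\mathbb{R}^n\times\mathbb{R}$, this solution is defined for all $t\in\mathbb{R}$. $D_{x_0}x(t;x_0,t_0)$ denotes the $n\times n$ Jacobian matrix of $x_0\mapsto x(t;x_0,t_0)$, and $\frac{\partial x}{\partial t_0}(t;x_0,t_0)\in\mathbb{R}^n$ denotes the partial derivative with respect to the initial time $t_0$. *)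

theory Defs
  imports "HOL-Analysis.Analysis"
begin

definition C1_vector_field :: "(real ^ 'n \<Rightarrow> real ^ 'n) \<Rightarrow> bool" where
  "C1_vector_field F \<longleftrightarrow>
     F differentiable_on UNIV \<and> continuous_on UNIV (\<lambda>x. jacobian F (at x))"

definition solves_ivp ::
  "(real ^ 'n \<Rightarrow> real ^ 'n) \<Rightarrow> real ^ 'n \<Rightarrow> real \<Rightarrow> (real \<Rightarrow> real ^ 'n) \<Rightarrow> bool" where
  "solves_ivp F x0 t0 x \<longleftrightarrow>
     x t0 = x0 \<and> (\<forall>t. (x has_vector_derivative F (x t)) (at t))"

text \<open>Only the existence of solutions on the whole real line is required; their uniqueness
  is a consequence of the regularity of the vector field and is not assumed.\<close>

definition global_flow :: "(real ^ 'n \<Rightarrow> real ^ 'n) \<Rightarrow> bool" where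
  "global_flow F \<longleftrightarrow> (\<forall>x0 t0. \<exists>x. solves_ivp F x0 t0 x)"

text \<open>The value \<open>x(t; x0, t0)\<close>. The description is meaningful when \<open>F\<close> is of class \<open>C\<^sup>1\<close>
  and has a global flow, since the solution on the real line then exists and is unique.\<close>

definition flow :: "(real ^ 'n \<Rightarrow> real ^ 'n) \<Rightarrow> real \<Rightarrow> real ^ 'n \<Rightarrow> real \<Rightarrow> real ^ 'n" where
  "flow F t x0 t0 = (THE x. solves_ivp F x0 t0 x) t"

end

theory Submission
  imports Defs
begin

text \<open>By uniqueness and autonomy, \<open>x(t; x\<^sub>0, t\<^sub>0) = \<phi> (t - t\<^sub>0) x\<^sub>0\<close> for a one-parameter group \<open>\<phi>\<close>.
  Gronwall's inequality gives local Lipschitz dependence of \<open>\<phi> t\<close> on the initial value and then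
  its differentiability, through a Cauchy criterion that avoids solving the variational equation.
  Differentiating \<open>\<phi> (s + t) x = \<phi> t (\<phi> s x)\<close> at \<open>s = 0\<close> gives \<open>D (\<phi> t) x (F x) = F (\<phi> t x)\<close>, while the
  derivative of \<open>\<phi> (t - t\<^sub>0) x\<close> in \<open>t\<^sub>0\<close> is \<open>- F (\<phi> (t - t\<^sub>0) x)\<close>.\<close>

section \<open>Gronwall estimates on a time interval around zero\<close>

text \<open>The squared norm is differentiable even where \<open>Z\<close> vanishes. By
  Cauchy-Schwarz and \<open>2 * (b * n) \<le> n\<^sup>2 + b\<^sup>2\<close> its derivative is at
  most \<open>2 * K + 1\<close> times itself plus \<open>b\<^sup>2\<close>, so an integrating factor
  yields the nonincreasing \<open>G\<close>.\<close>

lemma gronwall_forward: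
  fixes Z Z' :: "real \<Rightarrow> 'a::real_inner"
  assumes "0 \<le> t"
    and deriv: "\<And>s. \<lbrakk>0 \<le> s; s \<le> t\<rbrakk> \<Longrightarrow> (Z has_vector_derivative Z' s) (at s)"
    and bound: "\<And>s. \<lbrakk>0 \<le> s; s \<le> t\<rbrakk> \<Longrightarrow> norm (Z' s) \<le> K * norm (Z s) + b"
    and "0 \<le> K"
  shows "(norm (Z t))\<^sup>2 \<le> exp ((2 * K + 1) * t) * ((norm (Z 0))\<^sup>2 + b\<^sup>2 * t)"
proof -
  define c where "c = 2 * K + 1"
  define G where "G s = exp (- c * s) * (Z s \<bullet> Z s) - b\<^sup>2 * s" for s
  have "G t \<le> G 0"
  proof (rule DERIV_nonpos_imp_nonincreasing[OF \<open>0 \<le> t\<close>])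
    fix s assume s: "0 \<le> s" "s \<le> t"
    have "((\<lambda>s. Z s \<bullet> Z s) has_real_derivative Z s \<bullet> Z' s + Z' s \<bullet> Z s) (at s)"
      using bounded_bilinear.has_vector_derivative[OF bounded_bilinear_inner deriv[OF s] deriv[OF s]]
      by (simp add: has_real_derivative_iff_has_vector_derivative)
    then have "((\<lambda>s. Z s \<bullet> Z s) has_real_derivative 2 * (Z s \<bullet> Z' s)) (at s)"
      by (simp add: inner_commute)
    then have "(G has_real_derivative exp (- c * s) * (2 * (Z s \<bullet> Z' s) - c * (Z s \<bullet> Z s)) - b\<^sup>2) (at s)"
      unfolding G_def by (auto intro!: derivative_eq_intros simp: algebra_simps)
    moreover have "exp (- c * s) * (2 * (Z s \<bullet> Z' s) - c * (Z s \<bullet> Z s)) - b\<^sup>2 \<le> 0"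
    proof -
      let ?n = "norm (Z s)"
      have "Z s \<bullet> Z' s \<le> ?n * norm (Z' s)"
        by (rule norm_cauchy_schwarz)
      also have "\<dots> \<le> ?n * (K * ?n + b)"
        by (intro mult_left_mono bound s) auto
      finally have "Z s \<bullet> Z' s \<le> K * ?n\<^sup>2 + b * ?n"
        by (simp add: power2_eq_square algebra_simps)
      moreover have "2 * (b * ?n) \<le> ?n\<^sup>2 + b\<^sup>2"
        using sum_squares_bound[of b ?n] by simp
      ultimately have "2 * (Z s \<bullet> Z' s) - c * (Z s \<bullet> Z s) \<le> b\<^sup>2"
        unfolding c_def power2_norm_eq_inner[symmetric] by (simp add: algebra_simps)
      then have "exp (- c * s) * (2 * (Z s \<bullet> Z' s) - c * (Z s \<bullet> Z s)) \<le> exp (- c * s) * b\<^sup>2"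
        by simp
      \<comment> \<open>Forward time makes the integrating factor at most one, so the term
        \<open>- b\<^sup>2 * s\<close> in \<open>G\<close> covers what remains.\<close>
      also have "\<dots> \<le> 1 * b\<^sup>2"
        using s \<open>0 \<le> K\<close> by (intro mult_right_mono) (auto simp: c_def mult_nonpos_nonneg)
      finally show ?thesis by simp
    qed
    ultimately show "\<exists>y. DERIV G s :> y \<and> y \<le> 0" by blast
  qed
  then have "exp (- c * t) * (norm (Z t))\<^sup>2 \<le> (norm (Z 0))\<^sup>2 + b\<^sup>2 * t"
    by (simp add: G_def power2_norm_eq_inner)
  then have "exp (c * t) * (exp (- c * t) * (norm (Z t))\<^sup>2) \<le> exp (c * t) * ((norm (Z 0))\<^sup>2 + b\<^sup>2 * t)"
    by simp
  moreover have "exp (c * t) * (exp (- c * t) * (norm (Z t))\<^sup>2) = (norm (Z t))\<^sup>2"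
    by (simp flip: exp_add mult.assoc)
  ultimately have "(norm (Z t))\<^sup>2 \<le> exp (c * t) * ((norm (Z 0))\<^sup>2 + b\<^sup>2 * t)"
    by (simp only:)
  then show ?thesis unfolding c_def .
qed

text \<open>Negative times follow from the forward estimate for the time-reversed curve. Enlarging
  \<open>\<bar>t\<bar>\<close> to \<open>T\<close> makes the bound uniform on the interval.\<close>

lemma gronwall:
  fixes Z Z' :: "real \<Rightarrow> 'a::real_inner"
  assumes deriv: "\<And>s. \<bar>s\<bar> \<le> T \<Longrightarrow> (Z has_vector_derivative Z' s) (at s)"
    and bound: "\<And>s. \<bar>s\<bar> \<le> T \<Longrightarrow> norm (Z' s) \<le> K * norm (Z s) + b"
    and "0 \<le> K" "\<bar>t\<bar> \<le> T"
  shows "(norm (Z t))\<^sup>2 \<le> exp ((2 * K + 1) * T) * ((norm (Z 0))\<^sup>2 + b\<^sup>2 * T)"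
proof -
  have "(norm (Z t))\<^sup>2 \<le> exp ((2 * K + 1) * \<bar>t\<bar>) * ((norm (Z 0))\<^sup>2 + b\<^sup>2 * \<bar>t\<bar>)"
  proof (cases "0 \<le> t")
    case True
    then show ?thesis
      using gronwall_forward[of t Z Z' K b] assms by simp
  next
    case False
    define W where "W = (\<lambda>s. Z (- s))"
    have "(W has_vector_derivative - Z' (- s)) (at s)" if "0 \<le> s" "s \<le> - t" for s
    proof -
      have "(uminus has_vector_derivative - 1) (at s)"
        by (auto intro!: derivative_eq_intros simp flip: has_real_derivative_iff_has_vector_derivative)
      moreover have "(Z has_vector_derivative Z' (- s)) (at (- s))"
        using that assms by (intro deriv) auto
      ultimately have "((Z \<circ> uminus) has_vector_derivative - 1 *\<^sub>R Z' (- s)) (at s)"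
        by (rule vector_diff_chain_at)
      then show ?thesis by (simp add: W_def o_def)
    qed
    moreover have "norm (- Z' (- s)) \<le> K * norm (W s) + b" if "0 \<le> s" "s \<le> - t" for s
      using bound[of "- s"] that assms by (simp add: W_def)
    ultimately have "(norm (W (- t)))\<^sup>2 \<le> exp ((2 * K + 1) * (- t)) * ((norm (W 0))\<^sup>2 + b\<^sup>2 * (- t))"
      using False \<open>0 \<le> K\<close> by (intro gronwall_forward) auto
    then show ?thesis using False by (simp add: W_def)
  qed
  also have "\<dots> \<le> exp ((2 * K + 1) * T) * ((norm (Z 0))\<^sup>2 + b\<^sup>2 * T)"
    using assms by (intro mult_mono add_mono mult_left_mono) auto
  finally show ?thesis .
qed

text \<open>Connectedness of the segment from \<open>0\<close> to \<open>u\<close> gives the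
  crossing. Recording that \<open>v\<close> lies on this segment lets
  \<open>\<bar>v\<bar> = \<bar>u\<bar>\<close> force \<open>v = u\<close>.\<close>

lemma IVT_norm:
  fixes Z :: "real \<Rightarrow> 'a::real_normed_vector"
  assumes cont: "\<And>s. \<bar>s\<bar> \<le> T \<Longrightarrow> isCont Z s"
    and "norm (Z 0) \<le> r" "r \<le> norm (Z u)" "\<bar>u\<bar> \<le> T"
  obtains v where "\<bar>v\<bar> \<le> \<bar>u\<bar>" "norm (Z v) = r" "v \<in> closed_segment 0 u"
proof -
  have sub: "\<bar>v\<bar> \<le> \<bar>u\<bar>" if "v \<in> closed_segment 0 u" for v
    using that by (auto simp: closed_segment_eq_real_ivl split: if_splits)
  have "isCont Z v" if "v \<in> closed_segment 0 u" for v
    using sub[OF that] \<open>\<bar>u\<bar> \<le> T\<close> by (intro cont) linarith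
  then have "continuous_on (closed_segment 0 u) (\<lambda>s. norm (Z s))"
    by (intro continuous_on_norm continuous_at_imp_continuous_on ballI)
  then have "connected ((\<lambda>s. norm (Z s)) ` closed_segment 0 u)"
    by (intro connected_continuous_image connected_segment)
  moreover have "norm (Z 0) \<in> (\<lambda>s. norm (Z s)) ` closed_segment 0 u"
    "norm (Z u) \<in> (\<lambda>s. norm (Z s)) ` closed_segment 0 u"
    by (intro imageI ends_in_segment)+
  ultimately have "r \<in> (\<lambda>s. norm (Z s)) ` closed_segment 0 u"
    using assms(2,3) by (rule connectedD_interval)
  then show thesis using sub that by blast
qed

text \<open>If the differential inequality is known only inside the ball of radius \<open>r\<close>, the bound it
  yields prevents \<open>Z\<close> from ever reaching the boundary of that ball.\<close>

lemma gronwall_local: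
  fixes Z Z' :: "real \<Rightarrow> 'a::real_inner"
  assumes deriv: "\<And>s. \<bar>s\<bar> \<le> T \<Longrightarrow> (Z has_vector_derivative Z' s) (at s)"
    and bound: "\<And>s. \<lbrakk>\<bar>s\<bar> \<le> T; norm (Z s) \<le> r\<rbrakk> \<Longrightarrow> norm (Z' s) \<le> K * norm (Z s)"
    and small: "exp ((2 * K + 1) * T) * (norm (Z 0))\<^sup>2 < r\<^sup>2"
    and "0 \<le> r" "0 \<le> K" "\<bar>t\<bar> \<le> T"
  shows "norm (Z t) \<le> r \<and> (norm (Z t))\<^sup>2 \<le> exp ((2 * K + 1) * T) * (norm (Z 0))\<^sup>2"
proof -
  have cont: "isCont Z s" if "\<bar>s\<bar> \<le> T" for s
    using deriv[OF that] by (rule has_vector_derivative_continuous)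
  have "0 \<le> T" using assms by linarith
  have "1 * (norm (Z 0))\<^sup>2 \<le> exp ((2 * K + 1) * T) * (norm (Z 0))\<^sup>2"
    using \<open>0 \<le> T\<close> \<open>0 \<le> K\<close> by (intro mult_right_mono) auto
  with small have "(norm (Z 0))\<^sup>2 < r\<^sup>2" by linarith
  then have Z0: "norm (Z 0) < r"
    using \<open>0 \<le> r\<close> by (rule power2_less_imp_less)
  define S where "S = {s \<in> {-T..T}. norm (Z s) = r}"
  have "S = {}"
  proof (rule ccontr)
    assume "S \<noteq> {}"
    have "continuous_on {-T..T} (\<lambda>s. norm (Z s))"
      by (intro continuous_at_imp_continuous_on ballI continuous_norm cont) auto
    then have "closed S"
      unfolding S_def by (rule continuous_closed_preimage_constant) simp
    then have "compact ({-T..T} \<inter> S)" by (intro compact_Int_closed) auto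
    moreover have "{-T..T} \<inter> S = S" by (auto simp: S_def)
    ultimately have "compact S" by simp
    \<comment> \<open>Compactness of \<open>S\<close> provides a hitting time of the sphere of
      radius \<open>r\<close> nearest to zero, in either time direction.\<close>
    then obtain s where s: "s \<in> S" and min: "\<And>u. u \<in> S \<Longrightarrow> \<bar>s\<bar> \<le> \<bar>u\<bar>"
      using continuous_attains_inf[OF _ \<open>S \<noteq> {}\<close> continuous_on_rabs[OF continuous_on_id]] by blast
    have sT: "\<bar>s\<bar> \<le> T" and sr: "norm (Z s) = r" using s by (auto simp: S_def)
    \<comment> \<open>If \<open>Z u\<close> were outside, a crossing \<open>v\<close> would lie
      between \<open>0\<close> and \<open>u\<close>; minimality of \<open>s\<close> forces
      \<open>v = u\<close>, contradicting \<open>norm (Z v) = r\<close>.\<close>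
    have inside: "norm (Z u) \<le> r" if u: "\<bar>u\<bar> \<le> \<bar>s\<bar>" for u
    proof (rule ccontr)
      assume "\<not> norm (Z u) \<le> r"
      then have "norm (Z 0) \<le> r" "r \<le> norm (Z u)" "\<bar>u\<bar> \<le> T" using Z0 u sT by auto
      then obtain v where v: "\<bar>v\<bar> \<le> \<bar>u\<bar>" "norm (Z v) = r" "v \<in> closed_segment 0 u"
        using IVT_norm[OF cont] by blast
      then have "v \<in> S" using u sT by (auto simp: S_def)
      then have "\<bar>s\<bar> \<le> \<bar>v\<bar>" by (rule min)
      with v(1) u have "\<bar>v\<bar> = \<bar>u\<bar>" by linarith
      with v(3) have "v = u"
        by (auto simp: closed_segment_eq_real_ivl split: if_splits)
      with v \<open>\<not> norm (Z u) \<le> r\<close> show False by simp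
    qed
    \<comment> \<open>The differential inequality holds at all times up to
      \<open>\<bar>s\<bar>\<close>, so Gronwall puts \<open>norm (Z s)\<close> strictly below
      \<open>r\<close>.\<close>
    have "(norm (Z s))\<^sup>2 \<le> exp ((2 * K + 1) * \<bar>s\<bar>) * ((norm (Z 0))\<^sup>2 + 0\<^sup>2 * \<bar>s\<bar>)"
      using sT inside assms by (intro gronwall[of "\<bar>s\<bar>" Z Z' K 0 s]) auto
    also have "\<dots> \<le> exp ((2 * K + 1) * T) * (norm (Z 0))\<^sup>2"
      using sT \<open>0 \<le> K\<close> by (simp add: mult_right_mono mult_left_mono)
    also have "\<dots> < r\<^sup>2" by (rule small)
    finally show False by (simp add: sr)
  qed
  have inside: "norm (Z u) \<le> r" if u: "\<bar>u\<bar> \<le> T" for u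
  proof (rule ccontr)
    assume "\<not> norm (Z u) \<le> r"
    then have "norm (Z 0) \<le> r" "r \<le> norm (Z u)" using Z0 by auto
    then obtain v where v: "\<bar>v\<bar> \<le> \<bar>u\<bar>" "norm (Z v) = r"
      using IVT_norm[OF cont _ _ u] by blast
    then have "v \<in> S" using u by (auto simp: S_def)
    with \<open>S = {}\<close> show False by simp
  qed
  moreover have "(norm (Z t))\<^sup>2 \<le> exp ((2 * K + 1) * T) * ((norm (Z 0))\<^sup>2 + 0\<^sup>2 * T)"
    using inside assms by (intro gronwall[of T Z Z' K 0 t]) auto
  ultimately show ?thesis using \<open>\<bar>t\<bar> \<le> T\<close> by simp
qed

section \<open>A Cauchy criterion for differentiability\<close>

text \<open>Relations with two increments along the same line make the difference quotients Cauchy; those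
  with three make their limit additive.\<close>

lemma differentiable_Cauchy_criterion:
  fixes f :: "'a::euclidean_space \<Rightarrow> 'b::banach"
  defines "g \<equiv> \<lambda>x h. f (x + h) - f x"
  assumes almost: "\<And>e. 0 < e \<Longrightarrow> \<exists>d>0. \<forall>u v w a b c.
      norm u < d \<longrightarrow> norm v < d \<longrightarrow> norm w < d \<longrightarrow> a *\<^sub>R u + b *\<^sub>R v + c *\<^sub>R w = 0 \<longrightarrow>
      norm (a *\<^sub>R g x u + b *\<^sub>R g x v + c *\<^sub>R g x w)
        \<le> e * (\<bar>a\<bar> * norm u + \<bar>b\<bar> * norm v + \<bar>c\<bar> * norm w)"
  shows "f differentiable at x"
proof -
  define near where "near e d \<longleftrightarrow> (\<forall>u v w a b c.
      norm u < d \<longrightarrow> norm v < d \<longrightarrow> norm w < d \<longrightarrow> a *\<^sub>R u + b *\<^sub>R v + c *\<^sub>R w = 0 \<longrightarrow>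
      norm (a *\<^sub>R g x u + b *\<^sub>R g x v + c *\<^sub>R g x w)
        \<le> e * (\<bar>a\<bar> * norm u + \<bar>b\<bar> * norm v + \<bar>c\<bar> * norm w))" for e d
  have ex_near: "\<exists>d>0. near e d" if "0 < e" for e
    using almost[OF that] by (simp add: near_def)
  have nearD: "norm (a *\<^sub>R g x u + b *\<^sub>R g x v + c *\<^sub>R g x w)
      \<le> e * (\<bar>a\<bar> * norm u + \<bar>b\<bar> * norm v + \<bar>c\<bar> * norm w)"
    if "near e d" "norm u < d" "norm v < d" "norm w < d" "a *\<^sub>R u + b *\<^sub>R v + c *\<^sub>R w = 0"
    for e d a b c u v w
    using that unfolding near_def by blast
  \<comment> \<open>\<open>q n v\<close> is the difference quotient in direction \<open>v\<close>
    with step \<open>1 / (n + 1)\<close>; its limit \<open>L\<close> is the candidate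
    derivative.\<close>
  define q where "q n v = real (Suc n) *\<^sub>R g x (v /\<^sub>R real (Suc n))" for n v
  define L where "L v = lim (\<lambda>n. q n v)" for v
  have small: "\<forall>\<^sub>F n in sequentially. norm (v /\<^sub>R real (Suc n)) < d" if "0 < d" for v :: 'a and d
  proof -
    have "(\<lambda>n. inverse (real (Suc n)) *\<^sub>R v) \<longlonglongrightarrow> 0 *\<^sub>R v"
      by (intro tendsto_intros LIMSEQ_inverse_real_of_nat)
    then have "(\<lambda>n. norm (inverse (real (Suc n)) *\<^sub>R v)) \<longlonglongrightarrow> 0"
      by (intro tendsto_norm_zero) simp
    then show ?thesis using that by (rule order_tendstoD)
  qed
  have norm_q: "\<bar>real (Suc n)\<bar> * norm (v /\<^sub>R real (Suc n)) = norm v" for n and v :: 'a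
    by simp
  have scale_q: "(r * real (Suc n)) *\<^sub>R (v /\<^sub>R real (Suc n)) = r *\<^sub>R v" for n r and v :: 'a
    by (simp del: of_nat_Suc)
  have lim: "(\<lambda>n. q n v) \<longlonglongrightarrow> L v" for v
  proof -
    have "Cauchy (\<lambda>n. q n v)"
    proof (rule CauchyI)
      fix e :: real assume "0 < e"
      \<comment> \<open>Each of the two quotients contributes \<open>norm v\<close>; the added
        \<open>1\<close> covers \<open>v = 0\<close> and makes the final inequality strict.\<close>
      define e' where "e' = e / (2 * norm v + 1)"
      have "0 < 2 * norm v + 1" by (simp add: add_nonneg_pos)
      then have "0 < e'" using \<open>0 < e\<close> by (simp add: e'_def)
      from ex_near[OF this] obtain d where "0 < d" and d: "near e' d" by blast
      obtain N where N: "\<And>n. N \<le> n \<Longrightarrow> norm (v /\<^sub>R real (Suc n)) < d"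
        using small[OF \<open>0 < d\<close>] unfolding eventually_sequentially by blast
      have "norm (q m v - q n v) < e" if "N \<le> m" "N \<le> n" for m n
      proof -
        let ?M = "real (Suc m)" and ?N = "real (Suc n)"
        have "?M *\<^sub>R (v /\<^sub>R ?M) + (- ?N) *\<^sub>R (v /\<^sub>R ?N) + 0 *\<^sub>R 0 = 0"
          using scale_q[of 1 m v] scale_q[of "-1" n v] by (simp del: of_nat_Suc)
        from nearD[OF d N N _ this] that \<open>0 < d\<close>
        have "norm (q m v - q n v)
            \<le> e' * (\<bar>?M\<bar> * norm (v /\<^sub>R ?M) + \<bar>?N\<bar> * norm (v /\<^sub>R ?N))"
          by (simp add: q_def del: of_nat_Suc)
        also have "\<dots> = e' * (norm v + norm v)"
          by (simp only: norm_q)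
        also have "\<dots> < e' * (2 * norm v + 1)"
          using \<open>0 < e'\<close> by simp
        also have "\<dots> = e"
          using \<open>0 < 2 * norm v + 1\<close> by (simp add: e'_def)
        finally show ?thesis .
      qed
      then show "\<exists>M. \<forall>m\<ge>M. \<forall>n\<ge>M. norm (q m v - q n v) < e" by blast
    qed
    then show ?thesis
      unfolding L_def by (simp add: Cauchy_convergent_iff convergent_LIMSEQ_iff)
  qed
  \<comment> \<open>One relation among scaled copies of \<open>u\<close>, \<open>v\<close> and
    \<open>w\<close> gives additivity and homogeneity together: the defect of \<open>L\<close> is at
    most \<open>e * M\<close> for every positive \<open>e\<close>.\<close>
  have comb: "L (\<alpha> *\<^sub>R v + \<beta> *\<^sub>R w) = \<alpha> *\<^sub>R L v + \<beta> *\<^sub>R L w" for \<alpha> \<beta> v w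
  proof -
    define u where "u = \<alpha> *\<^sub>R v + \<beta> *\<^sub>R w"
    define M where "M = norm u + \<bar>\<alpha>\<bar> * norm v + \<bar>\<beta>\<bar> * norm w"
    have M: "0 \<le> M" unfolding M_def by (intro add_nonneg_nonneg mult_nonneg_nonneg) auto
    have lim3: "(\<lambda>n. q n u - \<alpha> *\<^sub>R q n v - \<beta> *\<^sub>R q n w) \<longlonglongrightarrow> L u - \<alpha> *\<^sub>R L v - \<beta> *\<^sub>R L w"
      by (intro tendsto_intros lim)
    have le: "norm (L u - \<alpha> *\<^sub>R L v - \<beta> *\<^sub>R L w) \<le> e * M" if "0 < e" for e
    proof -
      from ex_near[OF that] obtain d where "0 < d" and d: "near e d" by blast
      have "\<forall>\<^sub>F n in sequentially. norm (q n u - \<alpha> *\<^sub>R q n v - \<beta> *\<^sub>R q n w) \<le> e * M"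
        using small[OF \<open>0 < d\<close>, of u] small[OF \<open>0 < d\<close>, of v] small[OF \<open>0 < d\<close>, of w]
      proof eventually_elim
        case (elim n)
        let ?N = "real (Suc n)"
        have "(1 * ?N) *\<^sub>R (u /\<^sub>R ?N) + (- \<alpha> * ?N) *\<^sub>R (v /\<^sub>R ?N) + (- \<beta> * ?N) *\<^sub>R (w /\<^sub>R ?N) = 0"
          by (simp only: scale_q u_def) simp
        from nearD[OF d elim this]
        have "norm (q n u - \<alpha> *\<^sub>R q n v - \<beta> *\<^sub>R q n w) \<le>
           e * (\<bar>?N\<bar> * norm (u /\<^sub>R ?N) + \<bar>- \<alpha> * ?N\<bar> * norm (v /\<^sub>R ?N) + \<bar>- \<beta> * ?N\<bar> * norm (w /\<^sub>R ?N))"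
          by (simp add: q_def del: of_nat_Suc)
        also have "\<dots> = e * M"
          by (simp only: abs_mult abs_minus_cancel mult.assoc norm_q M_def)
        finally show ?case .
      qed
      then show ?thesis
        by (intro Lim_norm_ubound[OF _ lim3]) auto
    qed
    have "norm (L u - \<alpha> *\<^sub>R L v - \<beta> *\<^sub>R L w) \<le> 0"
    proof (rule field_le_epsilon)
      fix e :: real assume "0 < e"
      then have "norm (L u - \<alpha> *\<^sub>R L v - \<beta> *\<^sub>R L w) \<le> e / (M + 1) * M"
        using M by (intro le) auto
      also have "\<dots> \<le> 0 + e"
        using \<open>0 < e\<close> M by (simp add: field_simps)
      finally show "norm (L u - \<alpha> *\<^sub>R L v - \<beta> *\<^sub>R L w) \<le> 0 + e" .
    qed
    then have "L u - \<alpha> *\<^sub>R L v - \<beta> *\<^sub>R L w = 0" by simp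
    then show ?thesis by (simp add: u_def algebra_simps)
  qed
  have "linear L"
  proof (rule linearI)
    show "L (v + w) = L v + L w" for v w using comb[of 1 v 1 w] by simp
    show "L (r *\<^sub>R v) = r *\<^sub>R L v" for r v using comb[of r v 0 0] by simp
  qed
  then have "bounded_linear L" by (simp add: linear_conv_bounded_linear)
  moreover have "\<exists>d>0. \<forall>y. norm (y - x) < d \<longrightarrow>
      norm (f y - f x - L (y - x)) \<le> e * norm (y - x)" if "0 < e" for e
  proof -
    from ex_near[of "e / 2"] that obtain d where "0 < d" and d: "near (e / 2) d" by auto
    have "norm (f y - f x - L (y - x)) \<le> e * norm (y - x)" if y: "norm (y - x) < d" for y
    proof -
      define h where "h = y - x"
      have "\<forall>\<^sub>F n in sequentially. norm (g x h - q n h) \<le> e * norm h"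
        using small[OF \<open>0 < d\<close>, of h]
      proof eventually_elim
        case (elim n)
        let ?N = "real (Suc n)"
        \<comment> \<open>Relating \<open>h\<close> to its own fraction \<open>h / (n + 1)\<close>
          compares the full increment with \<open>q n h\<close>, and then with \<open>L h\<close> in
          the limit. Two terms of size \<open>norm h\<close> explain the choice
          \<open>e / 2\<close>.\<close>
        have "1 *\<^sub>R h + (- 1 * ?N) *\<^sub>R (h /\<^sub>R ?N) + 0 *\<^sub>R 0 = 0"
          by (simp only: scale_q) simp
        from nearD[OF d _ elim _ this] y \<open>0 < d\<close>
        have "norm (g x h - q n h) \<le> e / 2 * (norm h + \<bar>?N\<bar> * norm (h /\<^sub>R ?N))"
          by (simp add: q_def h_def del: of_nat_Suc)
        also have "\<dots> = e * norm h"
          by (simp only: norm_q) simp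
        finally show ?case .
      qed
      moreover have "(\<lambda>n. g x h - q n h) \<longlonglongrightarrow> g x h - L h"
        by (intro tendsto_intros lim)
      ultimately have "norm (g x h - L h) \<le> e * norm h"
        by (intro Lim_norm_ubound) auto
      then show ?thesis by (simp add: g_def h_def)
    qed
    with \<open>0 < d\<close> show ?thesis by blast
  qed
  ultimately have "(f has_derivative L) (at x)"
    unfolding has_derivative_at_alt by blast
  then show ?thesis by (auto simp: differentiable_def)
qed

section \<open>Local Lipschitz bounds and uniqueness of solutions\<close>

lemma has_vector_derivative_shift:
  assumes "(f has_vector_derivative f') (at (s + t))"
  shows "((\<lambda>s. f (s + t)) has_vector_derivative f') (at s)"
proof -
  have "((\<lambda>s. s + t) has_vector_derivative 1) (at s)"
    by (auto intro!: derivative_eq_intros simp flip: has_real_derivative_iff_has_vector_derivative)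
  from vector_diff_chain_at[OF this assms] show ?thesis by (simp add: o_def)
qed

lemma norm_bounded_on_interval:
  fixes x :: "real \<Rightarrow> 'a::real_normed_vector"
  assumes "\<And>s. isCont x s"
  obtains M where "\<And>s. \<lbrakk>a \<le> s; s \<le> b\<rbrakk> \<Longrightarrow> norm (x s) \<le> M"
proof -
  have "compact (x ` {a..b})"
    using assms by (intro compact_continuous_image continuous_at_imp_continuous_on) auto
  then obtain M where "\<forall>y\<in>x ` {a..b}. norm y \<le> M"
    using compact_imp_bounded bounded_iff by blast
  then show thesis by (intro that) auto
qed

text \<open>With derivatives as bounded linear maps, continuity of \<open>F'\<close> is meant in
  operator norm, and compactness turns it into bounds and uniform continuity on balls.\<close>

locale C1_field =
  fixes F :: "'a::euclidean_space \<Rightarrow> 'a" and F' :: "'a \<Rightarrow> 'a \<Rightarrow>\<^sub>L 'a"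
  assumes F_deriv: "\<And>x. (F has_derivative F' x) (at x)"
    and F'_cont: "continuous_on UNIV F'"
begin

text \<open>The continuous derivative is bounded on the compact ball, and convexity of the ball
  allows the mean value inequality.\<close>

lemma lipschitz_on_ball:
  obtains K where "0 \<le> K" "\<And>x. norm x \<le> M \<Longrightarrow> norm (F' x) \<le> K"
    "\<And>x y. \<lbrakk>norm x \<le> M; norm y \<le> M\<rbrakk> \<Longrightarrow> norm (F x - F y) \<le> K * norm (x - y)"
proof -
  have "compact (F' ` cball 0 M)"
    using F'_cont by (intro compact_continuous_image) (auto intro: continuous_on_subset)
  then obtain K where "0 < K" and K: "\<forall>y\<in>F' ` cball 0 M. norm y \<le> K"
    using compact_imp_bounded bounded_pos by blast
  show thesis
  proof
    show "0 \<le> K" using \<open>0 < K\<close> by simp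
    show *: "norm (F' x) \<le> K" if "norm x \<le> M" for x using K that by auto
    show "norm (F x - F y) \<le> K * norm (x - y)" if "norm x \<le> M" "norm y \<le> M" for x y
    proof (rule differentiable_bound[of "cball 0 M" F "\<lambda>x. blinfun_apply (F' x)"])
      show "(F has_derivative F' z) (at z within cball 0 M)" for z
        by (rule has_derivative_at_withinI[OF F_deriv])
      show "onorm (blinfun_apply (F' z)) \<le> K" if "z \<in> cball 0 M" for z
        using *[of z] that by (simp add: norm_blinfun.rep_eq)
    qed (use that in auto)
  qed
qed

text \<open>On a compact time interval both solutions stay in one ball, where \<open>F\<close> is
  Lipschitz. Their difference vanishes initially, so Gronwall with \<open>b = 0\<close> keeps it
  zero.\<close>

lemma solution_unique:
  assumes x: "\<And>t. (x has_vector_derivative F (x t)) (at t)"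
    and y: "\<And>t. (y has_vector_derivative F (y t)) (at t)"
    and init: "x t0 = y t0"
  shows "x = y"
proof
  fix t
  define T where "T = \<bar>t - t0\<bar>"
  obtain M1 where M1: "\<And>s. \<lbrakk>t0 - T \<le> s; s \<le> t0 + T\<rbrakk> \<Longrightarrow> norm (x s) \<le> M1"
    by (rule norm_bounded_on_interval[OF has_vector_derivative_continuous[OF x]]) blast
  obtain M2 where M2: "\<And>s. \<lbrakk>t0 - T \<le> s; s \<le> t0 + T\<rbrakk> \<Longrightarrow> norm (y s) \<le> M2"
    by (rule norm_bounded_on_interval[OF has_vector_derivative_continuous[OF y]]) blast
  obtain K where K: "0 \<le> K"
    "\<And>p q. \<lbrakk>norm p \<le> max M1 M2; norm q \<le> max M1 M2\<rbrakk> \<Longrightarrow> norm (F p - F q) \<le> K * norm (p - q)"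
    by (rule lipschitz_on_ball[of "max M1 M2"]) blast
  \<comment> \<open>The shift moves the common initial value to time zero, where
    \<open>gronwall\<close> is centred.\<close>
  define Z where "Z s = x (s + t0) - y (s + t0)" for s
  have "(norm (Z (t - t0)))\<^sup>2 \<le> exp ((2 * K + 1) * T) * ((norm (Z 0))\<^sup>2 + 0\<^sup>2 * T)"
  proof (rule gronwall[where Z' = "\<lambda>s. F (x (s + t0)) - F (y (s + t0))"])
    fix s :: real assume s: "\<bar>s\<bar> \<le> T"
    show "(Z has_vector_derivative F (x (s + t0)) - F (y (s + t0))) (at s)"
      unfolding Z_def by (intro has_vector_derivative_diff has_vector_derivative_shift x y)
    show "norm (F (x (s + t0)) - F (y (s + t0))) \<le> K * norm (Z s) + 0"
      using K(2)[of "x (s + t0)" "y (s + t0)"] M1[of "s + t0"] M2[of "s + t0"] s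
      by (simp add: Z_def max.coboundedI1 max.coboundedI2)
  qed (use K(1) in \<open>simp_all add: T_def\<close>)
  then show "x t = y t" by (simp add: Z_def init)
qed

end

section \<open>The flow and its dependence on the initial value\<close>

locale C1_flow = C1_field F F'
  for F :: "'a::euclidean_space \<Rightarrow> 'a" and F' :: "'a \<Rightarrow> 'a \<Rightarrow>\<^sub>L 'a" +
  fixes \<phi> :: "real \<Rightarrow> 'a \<Rightarrow> 'a"
  assumes flow_0: "\<And>x. \<phi> 0 x = x"
    and flow_deriv: "\<And>x t. ((\<lambda>s. \<phi> s x) has_vector_derivative F (\<phi> t x)) (at t)"
begin

lemma flow_cont: "isCont (\<lambda>s. \<phi> s x) t"
  by (rule has_vector_derivative_continuous[OF flow_deriv])

lemma flow_shift_deriv: "((\<lambda>s. \<phi> (s + t) x) has_vector_derivative F (\<phi> (s + t) x)) (at s)"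
  by (intro has_vector_derivative_shift flow_deriv)

text \<open>As functions of \<open>s\<close> both sides solve the equation, the left one by
  autonomy, and they agree at \<open>s = 0\<close>.\<close>

lemma flow_add: "\<phi> (s + t) x = \<phi> s (\<phi> t x)"
  using solution_unique[of "\<lambda>s. \<phi> (s + t) x" "\<lambda>s. \<phi> s (\<phi> t x)" 0]
  by (simp add: flow_shift_deriv flow_deriv flow_0 fun_eq_iff)

text \<open>The orbit of \<open>x\<close> stays in a ball of radius \<open>M\<close> up to time
  \<open>T\<close>. As long as another orbit is within distance one of it, the Lipschitz constant of
  the ball of radius \<open>M + 1\<close> applies; \<open>gronwall_local\<close> with
  \<open>r = 1\<close> shows that it never leaves that range.\<close>

lemma flow_lipschitz:
  assumes "0 \<le> T"
  obtains C d where "0 \<le> C" "0 < d"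
    "\<And>s y. \<lbrakk>\<bar>s\<bar> \<le> T; norm (y - x) < d\<rbrakk> \<Longrightarrow> norm (\<phi> s y - \<phi> s x) \<le> C * norm (y - x)"
proof -
  obtain M where M: "\<And>s. \<lbrakk>- T \<le> s; s \<le> T\<rbrakk> \<Longrightarrow> norm (\<phi> s x) \<le> M"
    by (rule norm_bounded_on_interval[OF flow_cont]) blast
  obtain K where K: "0 \<le> K"
    "\<And>p q. \<lbrakk>norm p \<le> M + 1; norm q \<le> M + 1\<rbrakk> \<Longrightarrow> norm (F p - F q) \<le> K * norm (p - q)"
    by (rule lipschitz_on_ball[of "M + 1"]) blast
  \<comment> \<open>A square root, because the Gronwall bound concerns squared norms. Initial
    distances below \<open>1 / C\<close> then meet the smallness condition of
    \<open>gronwall_local\<close>.\<close>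
  define C where "C = sqrt (exp ((2 * K + 1) * T))"
  have C: "0 < C" "C\<^sup>2 = exp ((2 * K + 1) * T)" by (auto simp: C_def)
  show thesis
  proof
    show "0 \<le> C" "0 < 1 / C" using C by auto
    fix s y assume s: "\<bar>s\<bar> \<le> T" and y: "norm (y - x) < 1 / C"
    define Z where "Z s = \<phi> s y - \<phi> s x" for s
    have Z0: "Z 0 = y - x" by (simp add: Z_def flow_0)
    have "C * norm (y - x) < 1" using y C(1) by (simp add: field_simps)
    then have "(C * norm (y - x))\<^sup>2 < 1\<^sup>2"
      using C(1) by (intro power_strict_mono) simp_all
    then have small: "exp ((2 * K + 1) * T) * (norm (Z 0))\<^sup>2 < 1\<^sup>2"
      by (simp only: Z0 power_mult_distrib C(2))
    have Z: "norm (Z s) \<le> 1 \<and> (norm (Z s))\<^sup>2 \<le> exp ((2 * K + 1) * T) * (norm (Z 0))\<^sup>2"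
    proof (rule gronwall_local[where Z' = "\<lambda>s. F (\<phi> s y) - F (\<phi> s x)"])
      fix s :: real assume s: "\<bar>s\<bar> \<le> T"
      show "(Z has_vector_derivative F (\<phi> s y) - F (\<phi> s x)) (at s)"
        unfolding Z_def by (intro has_vector_derivative_diff flow_deriv)
      assume "norm (Z s) \<le> 1"
      moreover have "norm (\<phi> s x) \<le> M" using s by (intro M) linarith+
      ultimately have "norm (\<phi> s y) \<le> M + 1" "norm (\<phi> s x) \<le> M + 1"
        using norm_triangle_sub[of "\<phi> s y" "\<phi> s x"] by (simp_all add: Z_def)
      then show "norm (F (\<phi> s y) - F (\<phi> s x)) \<le> K * norm (Z s)"
        unfolding Z_def by (rule K(2))
    qed (use small s K(1) in simp_all)
    from Z[THEN conjunct2] have "(norm (Z s))\<^sup>2 \<le> (C * norm (y - x))\<^sup>2"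
      by (simp only: Z0 power_mult_distrib C(2))
    then have "norm (Z s) \<le> C * norm (y - x)"
      by (rule power2_le_imp_le) (use C(1) in simp)
    then show "norm (\<phi> s y - \<phi> s x) \<le> C * norm (y - x)"
      by (simp add: Z_def)
  qed
qed

text \<open>Uniform continuity of \<open>F'\<close> on a ball around the orbit segment makes the
  first-order remainder small with a single \<open>d\<close> for all times.\<close>

lemma linearization_along_orbit:
  assumes "0 \<le> T" "0 < e"
  obtains d where "0 < d"
    "\<And>s p. \<lbrakk>\<bar>s\<bar> \<le> T; norm (p - \<phi> s x) < d\<rbrakk> \<Longrightarrow>
      norm (F p - F (\<phi> s x) - F' (\<phi> s x) (p - \<phi> s x)) \<le> e * norm (p - \<phi> s x)"
proof -
  obtain M where M: "\<And>s. \<lbrakk>- T \<le> s; s \<le> T\<rbrakk> \<Longrightarrow> norm (\<phi> s x) \<le> M"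
    by (rule norm_bounded_on_interval[OF flow_cont]) blast
  have "uniformly_continuous_on (cball 0 (M + 1)) F'"
    using F'_cont by (intro compact_uniformly_continuous) (auto intro: continuous_on_subset)
  then have "\<exists>d>0. \<forall>p\<in>cball 0 (M + 1). \<forall>q\<in>cball 0 (M + 1). dist q p < d \<longrightarrow> dist (F' q) (F' p) < e"
    unfolding uniformly_continuous_on_def using \<open>0 < e\<close> by (elim allE impE)
  then obtain d where "0 < d"
    and d: "\<forall>p\<in>cball 0 (M + 1). \<forall>q\<in>cball 0 (M + 1). dist q p < d \<longrightarrow> dist (F' q) (F' p) < e"
    by (elim exE conjE)
  show thesis
  proof
    \<comment> \<open>The cap \<open>1\<close> keeps \<open>p\<close> in the ball of radius
      \<open>M + 1\<close>, where uniform continuity is available.\<close>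
    show "0 < min d 1" using \<open>0 < d\<close> by simp
    fix s p assume s: "\<bar>s\<bar> \<le> T" and p: "norm (p - \<phi> s x) < min d 1"
    let ?c = "\<phi> s x" and ?S = "ball (\<phi> s x) (min d 1)"
    have c: "norm ?c \<le> M" using s by (intro M) linarith+
    have "norm (F p - F ?c - F' ?c (p - ?c)) \<le> norm (p - ?c) * e"
    proof (rule differentiable_bound_linearization[of ?c p ?S F "\<lambda>q. blinfun_apply (F' q)" ?c e])
      have "?c \<in> ?S" "p \<in> ?S" using \<open>0 < d\<close> p by (auto simp: dist_norm norm_minus_commute)
      then have "closed_segment ?c p \<subseteq> ?S" by (intro closed_segment_subset convex_ball)
      moreover have "?c + t *\<^sub>R (p - ?c) \<in> closed_segment ?c p" if "t \<in> {0..1}" for t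
        unfolding in_segment by (rule exI[of _ t]) (use that in \<open>simp add: scaleR_diff_left scaleR_diff_right\<close>)
      ultimately show "?c + t *\<^sub>R (p - ?c) \<in> ?S" if "t \<in> {0..1}" for t
        using that by (meson subsetD)
      show "(F has_derivative F' q) (at q within ?S)" for q
        by (rule has_derivative_at_withinI[OF F_deriv])
      show "?c \<in> ?S" using \<open>0 < d\<close> by simp
      show "onorm (blinfun_apply (F' q) - blinfun_apply (F' ?c)) \<le> e" if "q \<in> ?S" for q
      proof -
        have q: "dist q ?c < d" "norm (q - ?c) < 1"
          using that by (simp_all add: dist_norm norm_minus_commute)
        then have "norm q \<le> M + 1"
          using norm_triangle_sub[of q ?c] c by linarith
        then have "q \<in> cball 0 (M + 1)" "?c \<in> cball 0 (M + 1)" using c by auto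
        from d[rule_format, OF this(2,1) q(1)] have "norm (F' q - F' ?c) < e"
          unfolding dist_norm .
        then show ?thesis
          unfolding norm_blinfun.rep_eq minus_blinfun.rep_eq fun_diff_def by (rule less_imp_le)
      qed
    qed
    then show "norm (F p - F ?c - F' ?c (p - ?c)) \<le> e * norm (p - ?c)"
      by (simp add: mult.commute)
  qed
qed

text \<open>A combination of three nearby displacements solves the variational equation up to an
  error that is small relative to the displacements. If its initial value vanishes,
  Gronwall's inequality makes it small, which is what the Cauchy criterion asks for; the
  variational equation itself is never solved.\<close>

lemma flow_differentiable: "\<phi> t differentiable at x"
proof (rule differentiable_Cauchy_criterion)
  fix e :: real assume "0 < e"
  define T where "T = \<bar>t\<bar>"
  have "0 \<le> T" by (simp add: T_def)
  obtain M where M: "\<And>s. \<lbrakk>- T \<le> s; s \<le> T\<rbrakk> \<Longrightarrow> norm (\<phi> s x) \<le> M"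
    by (rule norm_bounded_on_interval[OF flow_cont]) blast
  obtain K where K: "0 \<le> K" "\<And>p. norm p \<le> M \<Longrightarrow> norm (F' p) \<le> K"
    by (rule lipschitz_on_ball[of M]) blast
  obtain C d1 where C: "0 \<le> C" and "0 < d1"
    and lip: "\<And>s y. \<lbrakk>\<bar>s\<bar> \<le> T; norm (y - x) < d1\<rbrakk> \<Longrightarrow> norm (\<phi> s y - \<phi> s x) \<le> C * norm (y - x)"
    by (rule flow_lipschitz[OF \<open>0 \<le> T\<close>, of x]) blast
  \<comment> \<open>\<open>E\<close> is the square root of the Gronwall factor of the forcing term;
    \<open>\<eta>\<close> is the linearization accuracy for which
    \<open>\<eta> * C * E \<le> e\<close>.\<close>
  define E where "E = sqrt (exp ((2 * K + 1) * T) * T)"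
  have E: "0 \<le> E" "E\<^sup>2 = exp ((2 * K + 1) * T) * T" using \<open>0 \<le> T\<close> by (auto simp: E_def)
  define \<eta> where "\<eta> = e / (C * E + 1)"
  have CE: "0 \<le> C * E" using C E by simp
  have "0 < \<eta>" using \<open>0 < e\<close> CE by (simp add: \<eta>_def add_nonneg_pos)
  have \<eta>: "\<eta> * C * E \<le> e"
    using \<open>0 < e\<close> CE by (simp add: \<eta>_def field_simps)
  obtain d2 where "0 < d2" and d2: "\<And>s p. \<lbrakk>\<bar>s\<bar> \<le> T; norm (p - \<phi> s x) < d2\<rbrakk> \<Longrightarrow>
      norm (F p - F (\<phi> s x) - F' (\<phi> s x) (p - \<phi> s x)) \<le> \<eta> * norm (p - \<phi> s x)"
    by (rule linearization_along_orbit[OF \<open>0 \<le> T\<close> \<open>0 < \<eta>\<close>, of x]) blast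
  \<comment> \<open>\<open>d1\<close> gives the Lipschitz estimate; \<open>d2 / (C + 1)\<close>
    keeps displaced orbits within \<open>d2\<close>, where the linearization holds. The added
    \<open>1\<close> covers \<open>C = 0\<close>.\<close>
  define d where "d = min d1 (d2 / (C + 1))"
  have "0 < d" using \<open>0 < d1\<close> \<open>0 < d2\<close> C by (simp add: d_def)
  define D where "D s h = \<phi> s (x + h) - \<phi> s x" for s h
  \<comment> \<open>\<open>R\<close> is the error by which the displacement \<open>D\<close> fails
    to solve the variational equation.\<close>
  define R where "R s h = F (\<phi> s (x + h)) - F (\<phi> s x) - F' (\<phi> s x) (D s h)" for s h
  have R: "norm (R s h) \<le> \<eta> * C * norm h" if "\<bar>s\<bar> \<le> T" "norm h < d" for s h
  proof -
    have D: "norm (D s h) \<le> C * norm h"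
      using lip[of s "x + h"] that by (simp add: D_def d_def)
    also have "C * norm h \<le> (C + 1) * norm h" by (simp add: algebra_simps)
    also have "(C + 1) * norm h < d2"
      using that(2) C by (simp add: d_def field_simps)
    finally have "norm (R s h) \<le> \<eta> * norm (D s h)"
      using d2[of s "\<phi> s (x + h)"] that unfolding R_def D_def by simp
    also have "\<dots> \<le> \<eta> * (C * norm h)"
      using D \<open>0 < \<eta>\<close> by (intro mult_left_mono) auto
    finally show ?thesis by (simp add: mult.assoc)
  qed
  have key: "norm (a *\<^sub>R D t u + b *\<^sub>R D t v + c *\<^sub>R D t w)
      \<le> e * (\<bar>a\<bar> * norm u + \<bar>b\<bar> * norm v + \<bar>c\<bar> * norm w)"
    if uvw: "norm u < d" "norm v < d" "norm w < d" and zero: "a *\<^sub>R u + b *\<^sub>R v + c *\<^sub>R w = 0"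
    for u v w a b c
  proof -
    define N where "N = \<bar>a\<bar> * norm u + \<bar>b\<bar> * norm v + \<bar>c\<bar> * norm w"
    have "0 \<le> N" unfolding N_def by (intro add_nonneg_nonneg mult_nonneg_nonneg) auto
    define Z where "Z s = a *\<^sub>R D s u + b *\<^sub>R D s v + c *\<^sub>R D s w" for s
    define Z' where "Z' s = F' (\<phi> s x) (Z s) + (a *\<^sub>R R s u + b *\<^sub>R R s v + c *\<^sub>R R s w)" for s
    have D_deriv: "((\<lambda>s. D s h) has_vector_derivative F' (\<phi> s x) (D s h) + R s h) (at s)" for s h
      using has_vector_derivative_diff[OF flow_deriv[of "x + h" s] flow_deriv[of x s]]
      by (simp add: D_def R_def)
    have "(norm (Z t))\<^sup>2 \<le> exp ((2 * K + 1) * T) * ((norm (Z 0))\<^sup>2 + (\<eta> * C * N)\<^sup>2 * T)"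
    proof (rule gronwall[where Z' = Z'])
      fix s :: real assume s: "\<bar>s\<bar> \<le> T"
      have "(Z has_vector_derivative a *\<^sub>R (F' (\<phi> s x) (D s u) + R s u)
          + b *\<^sub>R (F' (\<phi> s x) (D s v) + R s v) + c *\<^sub>R (F' (\<phi> s x) (D s w) + R s w)) (at s)"
        unfolding Z_def
        by (intro has_vector_derivative_add bounded_linear.has_vector_derivative[OF bounded_linear_scaleR_right] D_deriv)
      then show "(Z has_vector_derivative Z' s) (at s)"
        by (simp add: Z'_def Z_def blinfun.add_right blinfun.scaleR_right algebra_simps)
      have "norm (\<phi> s x) \<le> M" using s by (intro M) linarith+
      then have "norm (F' (\<phi> s x)) * norm (Z s) \<le> K * norm (Z s)"
        by (rule mult_right_mono[OF K(2) norm_ge_zero])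
      then have "norm (F' (\<phi> s x) (Z s)) \<le> K * norm (Z s)"
        by (rule order_trans[OF norm_blinfun])
      moreover have "norm (a *\<^sub>R R s u + b *\<^sub>R R s v + c *\<^sub>R R s w) \<le> \<eta> * C * N"
      proof -
        have "norm (a *\<^sub>R R s u + b *\<^sub>R R s v + c *\<^sub>R R s w)
            \<le> \<bar>a\<bar> * norm (R s u) + \<bar>b\<bar> * norm (R s v) + \<bar>c\<bar> * norm (R s w)"
          by (intro norm_triangle_mono) simp_all
        also have "\<dots> \<le> \<bar>a\<bar> * (\<eta> * C * norm u) + \<bar>b\<bar> * (\<eta> * C * norm v) + \<bar>c\<bar> * (\<eta> * C * norm w)"
          using s uvw by (intro add_mono mult_left_mono R) auto
        also have "\<dots> = \<eta> * C * N" by (simp add: N_def algebra_simps)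
        finally show ?thesis .
      qed
      ultimately show "norm (Z' s) \<le> K * norm (Z s) + \<eta> * C * N"
        unfolding Z'_def by (intro norm_triangle_mono)
    next
      show "\<bar>t\<bar> \<le> T" by (simp add: T_def)
    qed (rule K(1))
    \<comment> \<open>The relation among the increments says exactly that \<open>Z 0\<close>
      vanishes, so only the forcing term survives in the Gronwall bound.\<close>
    moreover have "Z 0 = 0" using zero by (simp add: Z_def D_def flow_0)
    ultimately have "(norm (Z t))\<^sup>2 \<le> E\<^sup>2 * (\<eta> * C * N)\<^sup>2"
      by (simp add: E(2) mult_ac)
    also have "\<dots> = (\<eta> * C * E * N)\<^sup>2"
      by (simp add: power_mult_distrib mult_ac)
    finally have "(norm (Z t))\<^sup>2 \<le> (\<eta> * C * E * N)\<^sup>2" .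
    moreover have "0 \<le> \<eta> * C * E * N"
      using \<open>0 \<le> N\<close> C E(1) \<open>0 < \<eta>\<close> by simp
    ultimately have "norm (Z t) \<le> \<eta> * C * E * N"
      by (rule power2_le_imp_le)
    also have "\<dots> \<le> e * N" using \<eta> \<open>0 \<le> N\<close> by (rule mult_right_mono)
    finally show ?thesis by (simp add: Z_def N_def)
  qed
  show "\<exists>d>0. \<forall>u v w a b c. norm u < d \<longrightarrow> norm v < d \<longrightarrow> norm w < d \<longrightarrow>
      a *\<^sub>R u + b *\<^sub>R v + c *\<^sub>R w = 0 \<longrightarrow>
      norm (a *\<^sub>R (\<phi> t (x + u) - \<phi> t x) + b *\<^sub>R (\<phi> t (x + v) - \<phi> t x) + c *\<^sub>R (\<phi> t (x + w) - \<phi> t x))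
        \<le> e * (\<bar>a\<bar> * norm u + \<bar>b\<bar> * norm v + \<bar>c\<bar> * norm w)"
    by (intro exI[of _ d] conjI allI impI \<open>0 < d\<close> key[unfolded D_def])
qed

section \<open>Joint regularity in state and time, and transport of the field\<close>

text \<open>Passing from \<open>\<phi> s y\<close> to \<open>\<phi> s x\<close> costs little by the
  Lipschitz estimate, uniform for \<open>s\<close> near \<open>t\<close>; from there to
  \<open>\<phi> t x\<close> continuity of a single orbit suffices.\<close>

lemma flow_jointly_cont: "isCont (\<lambda>(y, s). \<phi> s y) (x, t)"
proof -
  have "0 \<le> \<bar>t\<bar> + 1" by simp
  then obtain C d where "0 < d"
    and lip: "\<And>s y. \<lbrakk>\<bar>s\<bar> \<le> \<bar>t\<bar> + 1; norm (y - x) < d\<rbrakk> \<Longrightarrow> norm (\<phi> s y - \<phi> s x) \<le> C * norm (y - x)"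
    by (rule flow_lipschitz[where x = x]) blast
  have fst: "(fst \<longlongrightarrow> x) (at (x, t))" and snd: "(snd \<longlongrightarrow> t) (at (x, t))"
    using tendsto_fst[OF tendsto_ident_at, of "(x, t)" UNIV]
      tendsto_snd[OF tendsto_ident_at, of "(x, t)" UNIV]
    by auto
  have "\<forall>\<^sub>F z in at (x, t). norm (\<phi> (snd z) (fst z) - \<phi> (snd z) x) \<le> C * norm (fst z - x)"
    using tendstoD[OF fst \<open>0 < d\<close>] tendstoD[OF snd zero_less_one]
    by eventually_elim (auto simp: dist_norm intro!: lip)
  moreover have "((\<lambda>z. C * norm (fst z - x)) \<longlongrightarrow> 0) (at (x, t))"
    using fst by (intro tendsto_mult_right_zero tendsto_norm_zero) (simp add: LIM_zero)
  ultimately have "((\<lambda>z. \<phi> (snd z) (fst z) - \<phi> (snd z) x) \<longlongrightarrow> 0) (at (x, t))"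
    by (rule Lim_null_comparison)
  moreover have "((\<lambda>z. \<phi> (snd z) x) \<longlongrightarrow> \<phi> t x) (at (x, t))"
    using flow_cont snd by (rule isCont_tendsto_compose)
  ultimately have "((\<lambda>z. \<phi> (snd z) (fst z) - \<phi> (snd z) x + \<phi> (snd z) x) \<longlongrightarrow> 0 + \<phi> t x) (at (x, t))"
    by (rule tendsto_add)
  then show ?thesis by (simp add: isCont_def case_prod_unfold)
qed

text \<open>The partial derivative in the state exists at the point, and the one in time is
  \<open>F\<close> along the flow, hence jointly continuous; this is what the partial derivative
  criterion asks for.\<close>

lemma flow_jointly_differentiable: "(\<lambda>(y, s). \<phi> s y) differentiable at (x, t)"
proof -
  obtain D where D: "(\<phi> t has_derivative D) (at x)"
    using flow_differentiable by (auto simp: differentiable_def)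
  have "((\<lambda>(y, s). \<phi> s y) has_derivative
      (\<lambda>(h, k). D h + blinfun_scaleR_left (F (\<phi> t x)) k)) (at (x, t) within UNIV \<times> UNIV)"
  proof (rule has_derivative_partialsI[where fy = "\<lambda>y s. blinfun_scaleR_left (F (\<phi> s y))"])
    show "((\<lambda>s. \<phi> s y) has_derivative blinfun_scaleR_left (F (\<phi> s y))) (at s)" for y s
      using flow_deriv[of y s] by (simp add: has_vector_derivative_def)
    have "isCont (\<lambda>z. F (case z of (y, s) \<Rightarrow> \<phi> s y)) (x, t)"
      using flow_jointly_cont has_derivative_continuous[OF F_deriv] by (rule isCont_o2)
    then have "isCont (\<lambda>z. blinfun_scaleR_left (F (case z of (y, s) \<Rightarrow> \<phi> s y)) :: real \<Rightarrow>\<^sub>L 'a) (x, t)"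
      by (rule bounded_linear.isCont[OF bounded_linear_blinfun_scaleR_left])
    then show "continuous (at (x, t) within UNIV \<times> UNIV) (\<lambda>(y, s). blinfun_scaleR_left (F (\<phi> s y)))"
      unfolding UNIV_Times_UNIV case_prod_beta .
  qed (use D in auto)
  then show ?thesis by (auto simp: differentiable_def)
qed

text \<open>Both sides are the derivative of \<open>\<phi> (s + t) x\<close> at
  \<open>s = 0\<close>: the left by the group law and the chain rule, the right by the
  equation.\<close>

lemma flow_deriv_field:
  assumes "(\<phi> t has_derivative D) (at x)"
  shows "D (F x) = F (\<phi> t x)"
proof -
  have 1: "((\<lambda>s. \<phi> s x) has_derivative (\<lambda>h. h *\<^sub>R F x)) (at 0)"
    using flow_deriv[of x 0] by (simp add: has_vector_derivative_def flow_0)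
  have "((\<lambda>s. \<phi> t (\<phi> s x)) has_derivative (\<lambda>h. D (h *\<^sub>R F x))) (at 0)"
    using has_derivative_compose[OF 1, of "\<phi> t" D] assms by (simp add: flow_0)
  then have "((\<lambda>s. \<phi> (s + t) x) has_vector_derivative D (F x)) (at 0)"
    using has_derivative_bounded_linear[OF assms]
    by (simp add: has_vector_derivative_def flow_add[symmetric] add.commute
        linear_simps bounded_linear.linear linear_cmul)
  from vector_derivative_unique_at[OF this flow_shift_deriv[of t x 0]] show ?thesis
    by simp
qed

end

section \<open>Transfer to Jacobian matrices and arbitrary initial times\<close>

text \<open>Carries continuity of the Jacobian matrix over to continuity of the derivative in
  operator norm.\<close>

lemma bounded_linear_Blinfun_matrix:
  "bounded_linear (\<lambda>A :: real ^ 'n ^ 'm. Blinfun ((*v) A))"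
proof -
  have "linear (\<lambda>A :: real ^ 'n ^ 'm. Blinfun ((*v) A))"
    by (intro linearI blinfun_eqI)
      (simp_all add: bounded_linear_Blinfun_apply matrix_vector_mul_bounded_linear
        blinfun.add_left blinfun.scaleR_left matrix_vector_mult_add_rdistrib scaleR_matrix_vector_assoc)
  then show ?thesis by (simp add: linear_conv_bounded_linear)
qed

theorem proposition1:
  fixes F :: "real ^ 'n \<Rightarrow> real ^ 'n"
  assumes "C1_vector_field F"
    and "global_flow F"
  shows "(\<forall>t x0 t0. (\<lambda>(y, s). flow F t y s) differentiable at (x0, t0)) \<and>
         (\<forall>t x0. \<forall>t0\<in>{..<t}.
            vector_derivative (\<lambda>s. flow F t x0 s) (at t0)
              + jacobian (\<lambda>y. flow F t y t0) (at x0) *v F x0 = 0)"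
proof -
  define F' where "F' x = Blinfun ((*v) (jacobian F (at x)))" for x
  interpret C1_field F F'
  proof
    show "(F has_derivative F' x) (at x)" for x
      using assms(1) jacobian_works[of F "at x"]
      by (simp add: C1_vector_field_def differentiable_on_def F'_def bounded_linear_Blinfun_apply
          matrix_vector_mul_bounded_linear)
    show "continuous_on UNIV F'"
      using assms(1) unfolding C1_vector_field_def F'_def
      by (intro bounded_linear.continuous_on[OF bounded_linear_Blinfun_matrix]) auto
  qed
  \<comment> \<open>Uniqueness discharges the definite description, so any solution computes
    \<open>flow\<close>.\<close>
  have flow_eq: "flow F t x0 t0 = x t" if "solves_ivp F x0 t0 x" for t x0 t0 x
  proof -
    have "(THE x. solves_ivp F x0 t0 x) = x"
    proof (rule the_equality)
      show "y = x" if "solves_ivp F x0 t0 y" for y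
        using that \<open>solves_ivp F x0 t0 x\<close>
        by (intro solution_unique[where ?t0.0 = t0]) (simp_all add: solves_ivp_def)
    qed (rule that)
    then show ?thesis by (simp add: flow_def)
  qed
  have ex: "\<exists>x. solves_ivp F x0 t0 x" for x0 t0
    using assms(2) by (simp add: global_flow_def)
  define \<phi> where "\<phi> t x0 = flow F t x0 0" for t x0
  interpret C1_flow F F' \<phi>
  proof
    fix x0 and t :: real
    obtain x where x: "solves_ivp F x0 0 x" using ex by blast
    have "(\<lambda>s. \<phi> s x0) = x" using flow_eq[OF x] by (simp add: \<phi>_def)
    then have "solves_ivp F x0 0 (\<lambda>s. \<phi> s x0)" using x by simp
    then show "\<phi> 0 x0 = x0" "((\<lambda>s. \<phi> s x0) has_vector_derivative F (\<phi> t x0)) (at t)"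
      by (simp_all add: solves_ivp_def)
  qed
  \<comment> \<open>By autonomy the time-shifted orbit solves the problem with initial time
    \<open>t0\<close>.\<close>
  have flow: "flow F t x0 t0 = \<phi> (t - t0) x0" for t x0 t0
  proof (rule flow_eq)
    show "solves_ivp F x0 t0 (\<lambda>t. \<phi> (t - t0) x0)"
      using flow_shift_deriv[where t = "- t0"] by (simp add: solves_ivp_def flow_0)
  qed
  have "(\<lambda>(y, s). flow F t y s) differentiable at (x0, t0)" for t x0 t0
  proof -
    \<comment> \<open>The map \<open>(x0, t0) \<mapsto> flow F t x0 t0\<close> is the joint flow
      composed with this affine change of variables.\<close>
    have lin: "((\<lambda>z :: (real ^ 'n) \<times> real. (fst z, t - snd z)) has_derivative (\<lambda>z. (fst z, 0 - snd z)))
        (at (x0, t0))"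
      by (intro has_derivative_Pair has_derivative_diff has_derivative_const has_derivative_fst
          has_derivative_snd has_derivative_ident)
    obtain D where "((\<lambda>(y, s). \<phi> s y) has_derivative D) (at (fst (x0, t0), t - snd (x0, t0)))"
      using flow_jointly_differentiable[of x0 "t - t0"] unfolding differentiable_def fst_conv snd_conv
      by (rule exE)
    from has_derivative_compose[OF lin this] show ?thesis
      unfolding differentiable_def flow case_prod_unfold fst_conv snd_conv by - (rule exI)
  qed
  moreover have "vector_derivative (\<lambda>s. flow F t x0 s) (at t0)
      + jacobian (\<lambda>y. flow F t y t0) (at x0) *v F x0 = 0" for t x0 t0
  proof -
    \<comment> \<open>The inner derivative \<open>- 1\<close> supplies the sign that makes the two
      terms cancel.\<close>
    have "((\<lambda>s. t - s) has_vector_derivative - 1) (at t0)"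
      by (auto intro!: derivative_eq_intros simp flip: has_real_derivative_iff_has_vector_derivative)
    from vector_diff_chain_at[OF this flow_deriv]
    have "((\<lambda>s. \<phi> s x0) \<circ> (\<lambda>s. t - s) has_vector_derivative - 1 *\<^sub>R F (\<phi> (t - t0) x0)) (at t0)" .
    then have "vector_derivative (\<lambda>s. flow F t x0 s) (at t0) = - F (\<phi> (t - t0) x0)"
      by (intro vector_derivative_at) (simp add: flow o_def)
    moreover have "jacobian (\<phi> (t - t0)) (at x0) *v F x0 = F (\<phi> (t - t0) x0)"
      by (rule flow_deriv_field[OF jacobian_works[THEN iffD1, OF flow_differentiable]])
    ultimately show ?thesis by (simp add: flow)
  qed
  ultimately show ?thesis by (intro conjI allI ballI)
qed

end
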